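(* Let $f\colon\mathbb{N}\to [0,1]$, and suppose $\mathbf{N} = (N_s)_{s \in \mathbb{N}}$, $\mathbf{K}^+=(K^+_s)_{s\in\mathbb{N}}$, and $\mathbf{K}^-=(K^-_s)_{s\in\mathbb{N}}$ are sequences in $\mathbb{N}$ satisfying $1\prec \mathbf{K}^-\prec \mathbf{K}^+\preceq \mathbf{N}$. After replacing $(\mathbf{N},\mathbf{K}^+,\mathbf{K}^-)$ by a subsequence if necessary, there exist sequences $\mathbf{H}^+ = (H_s^+)_{s \in \mathbb{N}}$ and $\mathbf{H}^- = (H_s^-)_{s \in \mathbb{N}}$ with $\mathbf{K}^-\preceq \mathbf{H}^-\prec \mathbf{H}^+\preceq \mathbf{K}^+$ such that for any $\mathbf{H}=(H_s)_{s\in\mathbb{N}}$ with $\mathbf{H}^-\prec \mathbf{H}\prec \mathbf{H}^+$ the pair $(\mathbf{N},\mathbf{H})$ is a $U^1$ good scale for $f$.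
   Context: For sequences $\mathbf{N}=(N_s),\mathbf{H}=(H_s)$ in $\mathbb{N}$: $1\prec\mathbf{H}$ means $H_s\to\infty$; $\mathbf{H}\preceq\mathbf{N}$ means $H_s\le N_s$ for all large $s$; $\mathbf{H}\prec\mathbf{N}$ means $H_s/N_s\to 0$. A tuple $(\mathbf{N}'_1,\dots,\mathbf{N}'_k)$ is a subsequence of $(\mathbf{N}_1,\dots,\mathbf{N}_k)$ if there is a strictly increasing $t\colon\mathbb{N}\to\mathbb{N}$ with $N'_{i,s}=N_{i,t(s)}$ for all $i,s$. $\mathbb{E}_{n\in\mathbf{N}}a(n)=\lim_s\frac1{N_s}\sum_{n=1}^{N_s}a(n)$. For bounded $g$ and $1\prec\mathbf{H}\preceq\mathbf{N}$, $\|g\|_{U^1(\mathbf{N},\mathbf{H})}=\lim_{s\to\infty}\frac{1}{N_s-H_s+1}\sum_{n=1}^{N_s-H_s+1}\big|\frac{1}{H_s}\sum_{h=0}^{H_s-1}g(n+h)\big|$ (when the limit exists). $(\mathbf{N},\mathbf{H})$ with $1\prec\mathbf{H}\preceq\mathbf{N}$ is a $U^1$ good scale for $f\colon\mathbb{N}\to[0,1]$ if there is a decomposition $f=f_{\mathrm{str}}+f_{\mathrm{unf}}$ such that: (i) $0\le f_{\mathrm{str}}\le 1$ and $\mathbb{E}_{n\in\mathbf{N}}f_{\mathrm{unf}}(n)=0$; (ii) the set $\Gamma_s=\{n\in[N_s-H_s+1]: f_{\mathrm{str}}(n+m_1)=f_{\mathrm{str}}(n+m_2)~\forall m_1,m_2\in[H_s]\}$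 satisfies $|\Gamma_s|/(N_s-H_s+1)\to 1$; (iii) there is $\mathbf{H}'$ with $1\prec\mathbf{H}'\prec\mathbf{H}$ and $\|f_{\mathrm{unf}}\|_{U^1(\mathbf{N},\mathbf{H}')}=0$. Here $[M]=\{1,\dots,M\}$. *)

theory Defs
  imports Complex_Main
begin

text \<open>
  Here \<open>\<nat>\<close> is the set of positive integers. Functions on \<open>\<nat>\<close> are represented by functions on
  \<^typ>\<open>nat\<close> whose value at 0 is never used; sequences in \<open>\<nat>\<close> are functions
  \<^typ>\<open>nat \<Rightarrow> nat\<close> with positive values (the index starts at 0, which only shifts it).
\<close>

definition pos_seq :: "(nat \<Rightarrow> nat) \<Rightarrow> bool" where
  "pos_seq X \<longleftrightarrow> (\<forall>s. X s \<ge> 1)"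

definition one_prec :: "(nat \<Rightarrow> nat) \<Rightarrow> bool" where
  "one_prec H \<longleftrightarrow> filterlim H at_top sequentially"

definition seq_preceq :: "(nat \<Rightarrow> nat) \<Rightarrow> (nat \<Rightarrow> nat) \<Rightarrow> bool"  (infix \<open>\<preceq>\<^sub>s\<close> 50) where
  "H \<preceq>\<^sub>s N \<longleftrightarrow> (\<forall>\<^sub>F s in sequentially. H s \<le> N s)"

definition seq_prec :: "(nat \<Rightarrow> nat) \<Rightarrow> (nat \<Rightarrow> nat) \<Rightarrow> bool"  (infix \<open>\<prec>\<^sub>s\<close> 50) where
  "H \<prec>\<^sub>s N \<longleftrightarrow> (\<lambda>s. real (H s) / real (N s)) \<longlonglongrightarrow> 0"

text \<open>\<open>has_mean a N c\<close>: the limit defining \<open>\<bbbE>\<^bsub>n\<in>N\<^esub> a(n)\<close> exists and equals \<open>c\<close>.\<close>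

definition has_mean :: "(nat \<Rightarrow> real) \<Rightarrow> (nat \<Rightarrow> nat) \<Rightarrow> real \<Rightarrow> bool" where
  "has_mean a N c \<longleftrightarrow> (\<lambda>s. (1 / real (N s)) * (\<Sum>n = 1..N s. a n)) \<longlonglongrightarrow> c"

text \<open>
  \<open>has_U1_norm g N H c\<close>: the limit defining the \<open>U\<^sup>1(N,H)\<close> seminorm of \<open>g\<close> exists and equals \<open>c\<close>.
  It is used for \<open>H \<preceq>\<^sub>s N\<close>, where the natural-number subtraction is exact for all large \<open>s\<close>.
\<close>

definition has_U1_norm ::
    "(nat \<Rightarrow> real) \<Rightarrow> (nat \<Rightarrow> nat) \<Rightarrow> (nat \<Rightarrow> nat) \<Rightarrow> real \<Rightarrow> bool" where
  "has_U1_norm g N H c \<longleftrightarrow>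
     (\<lambda>s. (1 / real (N s - H s + 1)) *
           (\<Sum>n = 1..N s - H s + 1. \<bar>(1 / real (H s)) * (\<Sum>h = 0..<H s. g (n + h))\<bar>))
       \<longlonglongrightarrow> c"

definition Gamma_set :: "(nat \<Rightarrow> real) \<Rightarrow> (nat \<Rightarrow> nat) \<Rightarrow> (nat \<Rightarrow> nat) \<Rightarrow> nat \<Rightarrow> nat set" where
  "Gamma_set fstr N H s =
     {n \<in> {1..N s - H s + 1}.
        \<forall>m\<^sub>1\<in>{1..H s}. \<forall>m\<^sub>2\<in>{1..H s}. fstr (n + m\<^sub>1) = fstr (n + m\<^sub>2)}"

definition U1_good_scale ::
    "(nat \<Rightarrow> real) \<Rightarrow> (nat \<Rightarrow> nat) \<Rightarrow> (nat \<Rightarrow> nat) \<Rightarrow> bool" where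
  "U1_good_scale f N H \<longleftrightarrow>
     pos_seq N \<and> pos_seq H \<and> one_prec H \<and> H \<preceq>\<^sub>s N \<and>
     (\<exists>fstr funf :: nat \<Rightarrow> real.
        (\<forall>n\<ge>1. f n = fstr n + funf n) \<and>
        (\<forall>n\<ge>1. 0 \<le> fstr n \<and> fstr n \<le> 1) \<and>
        has_mean funf N 0 \<and>
        (\<lambda>s. real (card (Gamma_set fstr N H s)) / real (N s - H s + 1)) \<longlonglongrightarrow> 1 \<and>
        (\<exists>H'. pos_seq H' \<and> one_prec H' \<and> H' \<prec>\<^sub>s H \<and> has_U1_norm funf N H' 0))"

end

theory Submission imports Defs begin

text \<open>
  Write \<open>A\<^sub>M\<close> for averaging over the blocks \<open>[qM, (q+1)M)\<close>. Between \<open>K\<^sup>-\<close> and \<open>K\<^sup>+\<close>, place a ladder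
  of \<open>k\<^sup>2\<close> scales with consecutive ratio \<open>k\<close>. The energies \<open>\<parallel>A\<^sub>M f\<parallel>\<^sup>2\<close> decrease along the ladder, so by
  the pigeonhole principle some consecutive pair \<open>M, L = Mk\<close> has \<open>\<parallel>A\<^sub>M f - A\<^sub>L f\<parallel>\<^sup>2 \<le> k\<^sup>-\<^sup>2\<close>. Take
  \<open>H\<^sup>- = M\<close>, \<open>H\<^sup>+ = L\<close> and structured part \<open>A\<^sub>L f\<close>: windows much shorter than \<open>L\<close> rarely meet a
  block boundary, and on windows much longer than \<open>M\<close> the function \<open>f\<close> averages like \<open>A\<^sub>M f\<close>, hence
  like \<open>A\<^sub>L f\<close>. The parameter \<open>k\<close> tends to infinity with the stage \<open>s\<close>; passing to a subsequence along
  which \<open>N\<^sub>s\<close> grows superexponentially, the structured parts of the stages are glued together on the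
  intervals \<open>(N\<^sub>s\<^sub>-\<^sub>1, N\<^sub>s]\<close>, the earlier stages occupying a negligible part of \<open>[1, N\<^sub>s]\<close>.
\<close>

section \<open>Block averages as conditional expectations\<close>

text \<open>All blocks are aligned at 0, so the blocks of length \<open>M\<close> refine those of
  any multiple of \<open>M\<close>. The price is that the first block contains the index 0, whose
  value must be controlled separately.\<close>

definition block_avg :: "(nat \<Rightarrow> real) \<Rightarrow> nat \<Rightarrow> nat \<Rightarrow> real" where
  "block_avg f M n = (\<Sum>i = (n div M) * M..<(n div M) * M + M. f i) / real M"

lemma block_avg_cong_div: "m div M = n div M \<Longrightarrow> block_avg f M m = block_avg f M n"
  by (simp add: block_avg_def)

lemma block_avg_bounds:
  assumes "\<And>n. 0 \<le> f n \<and> f n \<le> 1"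
  shows "0 \<le> block_avg f M n" "block_avg f M n \<le> 1"
proof -
  show "0 \<le> block_avg f M n"
    unfolding block_avg_def using assms by (intro divide_nonneg_nonneg sum_nonneg) auto
  have "(\<Sum>i = (n div M) * M..<(n div M) * M + M. f i) \<le> (\<Sum>i = (n div M) * M..<(n div M) * M + M. 1)"
    using assms by (intro sum_mono) auto
  then show "block_avg f M n \<le> 1"
    unfolding block_avg_def by (auto simp: divide_le_eq_1)
qed

text \<open>\<open>block_avg f M\<close> is the orthogonal projection onto functions constant on blocks of length \<open>M\<close>.\<close>

lemma sum_block_avg_mult:
  assumes "M > 0" "M dvd T" and c: "\<And>m n. m div M = n div M \<Longrightarrow> c m = c n"
  shows "(\<Sum>n<T. block_avg f M n * c n) = (\<Sum>n<T. f n * c n)"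
proof -
  obtain Q where T: "T = Q * M" using assms(2) by (metis dvd_def mult.commute)
  have "(\<Sum>n = q * M..<q * M + M. block_avg f M n * c n) = (\<Sum>n = q * M..<q * M + M. f n * c n)" for q
  proof -
    have d: "n div M = q" if "n \<in> {q * M..<q * M + M}" for n
      using that assms(1) by (intro div_nat_eqI) (auto simp: mult.commute)
    have "(\<Sum>n = q * M..<q * M + M. block_avg f M n * c n)
        = (\<Sum>n = q * M..<q * M + M. (\<Sum>i = q * M..<q * M + M. f i) / real M * c (q * M))"
      using assms(1) by (intro sum.cong refl) (auto simp: block_avg_def d intro!: c)
    also have "\<dots> = (\<Sum>i = q * M..<q * M + M. f i) * c (q * M)"
      using assms(1) by simp
    also have "\<dots> = (\<Sum>n = q * M..<q * M + M. f n * c n)"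
      unfolding sum_distrib_right
      using assms(1) by (intro sum.cong refl) (auto simp: d intro!: c)
    finally show ?thesis .
  qed
  then show ?thesis
    unfolding T by (simp flip: sum.nat_group)
qed

text \<open>The coarse average is constant on fine blocks, so its inner products with
  \<open>f\<close>, with the fine average and with itself all coincide. The cross term therefore
  equals the coarse energy.\<close>

lemma block_avg_pythagoras:
  assumes "M > 0" "M dvd M'" "M' dvd T" "M' > 0"
  shows "(\<Sum>n<T. (block_avg f M n - block_avg f M' n)\<^sup>2)
       = (\<Sum>n<T. (block_avg f M n)\<^sup>2) - (\<Sum>n<T. (block_avg f M' n)\<^sup>2)"
proof -
  obtain r where r: "M' = M * r" using assms(2) by (auto simp: dvd_def)
  have c: "block_avg f M' m = block_avg f M' n" if "m div M = n div M" for m n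
    by (rule block_avg_cong_div) (simp add: r div_mult2_eq that)
  have "(\<Sum>n<T. block_avg f M n * block_avg f M' n) = (\<Sum>n<T. f n * block_avg f M' n)"
    using assms by (intro sum_block_avg_mult c) (auto dest: dvd_trans)
  moreover have "(\<Sum>n<T. block_avg f M' n * block_avg f M' n) = (\<Sum>n<T. f n * block_avg f M' n)"
    using assms by (intro sum_block_avg_mult block_avg_cong_div) auto
  ultimately have eq: "(\<Sum>n<T. block_avg f M n * block_avg f M' n) = (\<Sum>n<T. (block_avg f M' n)\<^sup>2)"
    by (simp add: power2_eq_square)
  have "(\<Sum>n<T. (block_avg f M n - block_avg f M' n)\<^sup>2)
      = (\<Sum>n<T. (block_avg f M n)\<^sup>2 + (block_avg f M' n)\<^sup>2 - 2 * (block_avg f M n * block_avg f M' n))"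
    by (intro sum.cong refl) (simp add: power2_diff)
  also have "\<dots> = (\<Sum>n<T. (block_avg f M n)\<^sup>2) + (\<Sum>n<T. (block_avg f M' n)\<^sup>2)
      - 2 * (\<Sum>n<T. block_avg f M n * block_avg f M' n)"
    by (simp add: sum.distrib sum_subtractf sum_distrib_left)
  finally show ?thesis using eq by simp
qed

lemma abs_diff_le_1:
  fixes x y :: real
  shows "0 \<le> x \<Longrightarrow> x \<le> 1 \<Longrightarrow> 0 \<le> y \<Longrightarrow> y \<le> 1 \<Longrightarrow> \<bar>x - y\<bar> \<le> 1"
  by linarith

text \<open>Complete blocks cancel exactly; only the last, incomplete block remains, with fewer than
  \<open>M\<close> terms of size at most 1.\<close>

lemma abs_sum_diff_block_avg_le:
  assumes f: "\<And>n. 0 \<le> f n \<and> f n \<le> 1" and "M > 0"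
  shows "\<bar>\<Sum>n<x. f n - block_avg f M n\<bar> \<le> real M"
proof -
  let ?T = "x div M * M"
  have "(\<Sum>n<?T. f n - block_avg f M n) = 0"
    using sum_block_avg_mult[of M ?T "\<lambda>_. 1" f] assms(2) by (simp add: sum_subtractf)
  moreover have "(\<Sum>n<x. f n - block_avg f M n)
      = (\<Sum>n<?T. f n - block_avg f M n) + (\<Sum>n = ?T..<x. f n - block_avg f M n)"
    by (metis atLeast0LessThan div_times_less_eq_dividend le0 sum.atLeastLessThan_concat)
  moreover have "\<bar>\<Sum>n = ?T..<x. f n - block_avg f M n\<bar> \<le> (\<Sum>n = ?T..<x. 1)"
    by (intro order.trans[OF sum_abs] sum_mono abs_diff_le_1) (use f block_avg_bounds[OF f] in auto)
  moreover have "real (x - ?T) \<le> real M"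
    using assms(2) by (simp only: minus_div_mult_eq_mod of_nat_le_iff less_imp_le mod_less_divisor)
  ultimately show ?thesis by (simp del: of_nat_diff)
qed

section \<open>Energy pigeonhole: a stable pair of scales\<close>

text \<open>If every decrement exceeded \<open>C / J\<close>, telescoping would make the total drop
  exceed \<open>C\<close>.\<close>

lemma exists_small_increment:
  fixes E :: "nat \<Rightarrow> real"
  assumes "J > 0" "E 0 \<le> C" "E J \<ge> 0"
  shows "\<exists>j<J. E j - E (Suc j) \<le> C / real J"
proof (rule ccontr)
  assume "\<not> ?thesis"
  then have "(\<Sum>j<J. C / real J) < (\<Sum>j<J. E j - E (Suc j))"
    using assms(1) by (intro sum_strict_mono) auto
  also have "\<dots> = E 0 - E J" by (rule sum_lessThan_telescope')
  finally show False using assms by simp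
qed

text \<open>With \<open>k\<^sup>2\<close> steps some energy drop is at most a fraction
  \<open>1 / k\<^sup>2\<close> of the length, which gives order \<open>1 / k\<close> in mean
  absolute value. The spare factor \<open>k\<close> in the last hypothesis makes the part of
  \<open>[1, N]\<close> outside complete top blocks equally small.\<close>

lemma exists_stable_scale:
  assumes f: "\<And>n. 0 \<le> f n \<and> f n \<le> 1"
    and "K > 0" "k > 0" "K * k ^ (k\<^sup>2) * k \<le> N"
  shows "\<exists>M\<ge>K. M * k \<le> K * k ^ (k\<^sup>2) \<and>
           (\<Sum>m = 1..N. \<bar>block_avg f M m - block_avg f (M * k) m\<bar>) \<le> 3 * real N / real k"
proof -
  define L where "L = K * k ^ (k\<^sup>2)"
  \<comment> \<open>Truncating to a multiple of the top scale makes every scale of the ladder divide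
    \<open>T\<close>, so that Pythagoras is exact.\<close>
  define T where "T = N div L * L"
  define E where "E j = (\<Sum>n<T. (block_avg f (K * k ^ j) n)\<^sup>2)" for j
  have L: "L > 0" using assms by (simp add: L_def)
  have TN: "T \<le> N" by (simp add: T_def)
  have NT: "N - T < L" using L by (simp add: T_def minus_div_mult_eq_mod)
  have LN: "real L \<le> real N / real k"
  proof -
    have "real (L * k) \<le> real N" using assms(4) unfolding L_def of_nat_le_iff .
    then show ?thesis using assms(3) by (simp add: field_simps)
  qed
  note b = block_avg_bounds[OF f]
  have "E 0 \<le> (\<Sum>n<T. 1)"
    unfolding E_def by (intro sum_mono power_le_one b)
  then have "\<exists>j<k\<^sup>2. E j - E (Suc j) \<le> real T / real (k\<^sup>2)"
    using assms(3) by (intro exists_small_increment) (auto simp: E_def intro!: sum_nonneg)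
  then obtain j where j: "j < k\<^sup>2" "E j - E (Suc j) \<le> real T / real (k\<^sup>2)" by blast
  define M where "M = K * k ^ j"
  have Mk: "M * k = K * k ^ Suc j" by (simp add: M_def)
  have M: "M > 0" using assms by (simp add: M_def)
  have "M * k dvd L"
    unfolding Mk L_def using j(1) by (intro mult_dvd_mono le_imp_power_dvd) auto
  then have dvd: "M * k dvd T" by (simp add: T_def)
  let ?d = "\<lambda>m. \<bar>block_avg f M m - block_avg f (M * k) m\<bar>"
  have "(\<Sum>n<T. (block_avg f M n - block_avg f (M * k) n)\<^sup>2) = E j - E (Suc j)"
    using M assms(3) dvd unfolding E_def Mk[symmetric] M_def[symmetric]
    by (intro block_avg_pythagoras) auto
  then have sq: "(\<Sum>n<T. (?d n)\<^sup>2) \<le> real T / (real k)\<^sup>2" using j(2) by simp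
  \<comment> \<open>Pointwise passage from squares to absolute values: either the difference is at
    most \<open>1 / k\<close>, or multiplying it by \<open>k\<close> times itself does not decrease
    it.\<close>
  have "?d n \<le> real k * (?d n)\<^sup>2 + 1 / real k" for n
  proof (cases "?d n \<le> 1 / real k")
    case True
    have "0 \<le> real k * (?d n)\<^sup>2" by (intro mult_nonneg_nonneg) auto
    with True show ?thesis by linarith
  next
    case False
    then have "1 \<le> real k * ?d n" using assms(3) by (simp add: field_simps)
    then have "?d n * 1 \<le> ?d n * (real k * ?d n)" by (intro mult_left_mono) auto
    also have "\<dots> = real k * (?d n)\<^sup>2" by (simp only: power2_eq_square mult_ac)
    also have "\<dots> \<le> real k * (?d n)\<^sup>2 + 1 / real k" by simp
    finally show ?thesis by simp
  qed
  then have "(\<Sum>n<T. ?d n) \<le> (\<Sum>n<T. real k * (?d n)\<^sup>2 + 1 / real k)"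
    by (intro sum_mono)
  also have "\<dots> = real k * (\<Sum>n<T. (?d n)\<^sup>2) + real T / real k"
    by (simp only: sum.distrib sum_distrib_left sum_constant card_lessThan) simp
  also have "\<dots> \<le> real k * (real T / (real k)\<^sup>2) + real T / real k"
    using sq by (intro add_right_mono mult_left_mono) auto
  also have "\<dots> = 2 * real T / real k" using assms(3) by (simp add: power2_eq_square)
  also have "\<dots> \<le> 2 * real N / real k" using TN by (intro divide_right_mono) auto
  finally have 1: "(\<Sum>n<T. ?d n) \<le> 2 * real N / real k" .
  \<comment> \<open>The tail has \<open>N - T + 1\<close> points, at most \<open>L\<close> because
    \<open>N - T < L\<close>.\<close>
  have "(\<Sum>n = T..N. ?d n) \<le> (\<Sum>n = T..N. 1)"
    by (intro sum_mono abs_diff_le_1 b)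
  also have "\<dots> \<le> real L" using TN NT by simp
  finally have 2: "(\<Sum>n = T..N. ?d n) \<le> real N / real k" using LN by simp
  have "(\<Sum>m = 1..N. ?d m) \<le> (\<Sum>m \<in> {..<T} \<union> {T..N}. ?d m)"
    by (intro sum_mono2) auto
  also have "\<dots> = (\<Sum>n<T. ?d n) + (\<Sum>n = T..N. ?d n)"
    by (intro sum.union_disjoint) auto
  also have "\<dots> \<le> 2 * real N / real k + real N / real k" by (intro add_mono 1 2)
  also have "\<dots> = 3 * real N / real k" by (simp add: field_simps)
  finally have fin: "(\<Sum>m = 1..N. ?d m) \<le> 3 * real N / real k" .
  have "M \<ge> K" using assms by (simp add: M_def)
  moreover have "M * k \<le> K * k ^ (k\<^sup>2)"
    using \<open>M * k dvd L\<close> L unfolding L_def by (rule dvd_imp_le)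
  ultimately show ?thesis using fin by blast
qed

section \<open>Sliding windows and block boundaries\<close>

text \<open>After swapping the sums, each of the \<open>H\<close> shifts contributes a sum over a
  subinterval of \<open>[1, N]\<close>.\<close>

lemma sum_sliding_window_le:
  fixes u :: "nat \<Rightarrow> real"
  assumes "\<And>n. 0 \<le> u n" "1 \<le> H" "H \<le> N"
  shows "(\<Sum>n = 1..N - H + 1. \<Sum>h = 0..<H. u (n + h)) \<le> real H * (\<Sum>m = 1..N. u m)"
proof -
  have "(\<Sum>n = 1..N - H + 1. \<Sum>h = 0..<H. u (n + h)) = (\<Sum>h = 0..<H. \<Sum>n = 1..N - H + 1. u (n + h))"
    by (rule sum.swap)
  also have "\<dots> \<le> (\<Sum>h = 0..<H. \<Sum>m = 1..N. u m)"
  proof (rule sum_mono)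
    fix h assume "h \<in> {0..<H}"
    have "(\<Sum>n = 1..N - H + 1. u (n + h)) = (\<Sum>m = 1 + h..N - H + 1 + h. u m)"
      by (rule sum.shift_bounds_cl_nat_ivl[symmetric])
    also have "\<dots> \<le> (\<Sum>m = 1..N. u m)"
    proof (rule sum_mono2)
      show "{1 + h..N - H + 1 + h} \<subseteq> {1..N}"
        using \<open>h \<in> {0..<H}\<close> assms(3) by auto
    qed (simp_all add: assms(1))
    finally show "(\<Sum>n = 1..N - H + 1. u (n + h)) \<le> (\<Sum>m = 1..N. u m)" .
  qed
  finally show ?thesis by simp
qed

text \<open>A window sum of \<open>f - block_avg f M\<close> is a difference of two partial sums,
  each at most \<open>M\<close> in size. What remains is an L1 distance, with \<open>g\<close> left
  arbitrary so that the glued structured part can be inserted.\<close>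

lemma window_averages_le:
  assumes f: "\<And>n. 0 \<le> f n \<and> f n \<le> 1" and "M > 0" "1 \<le> H" "H \<le> N"
  shows "(\<Sum>n = 1..N - H + 1. \<bar>(1 / real H) * (\<Sum>h = 0..<H. f (n + h) - g (n + h))\<bar>)
       \<le> 2 * real N * (real M / real H) + (\<Sum>m = 1..N. \<bar>block_avg f M m - g m\<bar>)"
proof -
  let ?a = "block_avg f M"
  have w: "\<bar>\<Sum>h = 0..<H. f (n + h) - ?a (n + h)\<bar> \<le> 2 * real M" for n
  proof -
    have "(\<Sum>h = 0..<H. f (n + h) - ?a (n + h)) = (\<Sum>i = n..<n + H. f i - ?a i)"
      using sum.shift_bounds_nat_ivl[where g = "\<lambda>i. f i - ?a i" and m = 0 and k = n and n = H] by (simp add: add.commute)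
    also have "\<dots> = (\<Sum>i<n + H. f i - ?a i) - (\<Sum>i<n. f i - ?a i)"
      using sum.atLeastLessThan_concat[where g = "\<lambda>i. f i - ?a i" and m = 0 and n = n and p = "n + H"] by (simp add: atLeast0LessThan)
    finally show ?thesis
      using abs_sum_diff_block_avg_le[of f M n, OF f assms(2)] abs_sum_diff_block_avg_le[of f M "n + H", OF f assms(2)]
      by linarith
  qed
  have p: "\<bar>(1 / real H) * (\<Sum>h = 0..<H. f (n + h) - g (n + h))\<bar>
      \<le> 2 * (real M / real H) + (1 / real H) * (\<Sum>h = 0..<H. \<bar>?a (n + h) - g (n + h)\<bar>)" for n
  proof -
    have "\<bar>\<Sum>h = 0..<H. f (n + h) - g (n + h)\<bar>
        = \<bar>(\<Sum>h = 0..<H. f (n + h) - ?a (n + h)) + (\<Sum>h = 0..<H. ?a (n + h) - g (n + h))\<bar>"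
      by (simp flip: sum.distrib)
    also have "\<dots> \<le> 2 * real M + (\<Sum>h = 0..<H. \<bar>?a (n + h) - g (n + h)\<bar>)"
      using w[of n] sum_abs[of "\<lambda>h. ?a (n + h) - g (n + h)" "{0..<H}"] by linarith
    finally show ?thesis
      using assms(3) by (simp add: abs_mult field_simps)
  qed
  have "(\<Sum>n = 1..N - H + 1. \<bar>(1 / real H) * (\<Sum>h = 0..<H. f (n + h) - g (n + h))\<bar>)
      \<le> (\<Sum>n = 1..N - H + 1. 2 * (real M / real H) + (1 / real H) * (\<Sum>h = 0..<H. \<bar>?a (n + h) - g (n + h)\<bar>))"
    by (intro sum_mono p)
  also have "\<dots> = real (N - H + 1) * (2 * (real M / real H))
      + (1 / real H) * (\<Sum>n = 1..N - H + 1. \<Sum>h = 0..<H. \<bar>?a (n + h) - g (n + h)\<bar>)"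
    by (simp only: sum.distrib sum_constant card_atLeastAtMost flip: sum_distrib_left) simp
  also have "\<dots> \<le> real N * (2 * (real M / real H))
      + (1 / real H) * (real H * (\<Sum>m = 1..N. \<bar>?a m - g m\<bar>))"
    using assms by (intro add_mono mult_left_mono mult_right_mono sum_sliding_window_le) auto
  finally show ?thesis using assms(3) by (simp add: mult_ac)
qed

text \<open>If \<open>n + 1\<close> and \<open>n + H\<close> lie in different blocks, a multiple
  \<open>q * L\<close> separates them, and each \<open>q\<close> accounts for at most
  \<open>H\<close> values of \<open>n\<close>. The range from \<open>n + 1\<close> to
  \<open>n + H\<close> is the one tested by \<open>Gamma_set\<close>.\<close>

lemma card_block_crossing_le:
  assumes "L > 0" "H \<ge> 1"
  shows "card {n. n + H \<le> N \<and> (n + 1) div L \<noteq> (n + H) div L} \<le> (N div L) * H"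
proof -
  have "{n. n + H \<le> N \<and> (n + 1) div L \<noteq> (n + H) div L} \<subseteq> (\<Union>q\<in>{1..N div L}. {q * L - H..<q * L})"
  proof
    fix n assume "n \<in> {n. n + H \<le> N \<and> (n + 1) div L \<noteq> (n + H) div L}"
    then have n: "n + H \<le> N" "(n + 1) div L \<noteq> (n + H) div L" by auto
    define q where "q = (n + H) div L"
    have "(n + 1) div L < q"
      using n assms(2) div_le_mono[of "n + 1" "n + H" L] unfolding q_def by linarith
    then have "n + 1 < q * L" using assms by (simp add: div_less_iff_less_mult)
    moreover have "q * L \<le> n + H" by (simp add: q_def)
    moreover have "q \<le> N div L" unfolding q_def using n by (intro div_le_mono)
    moreover have "q \<ge> 1" using \<open>(n + 1) div L < q\<close> by simp
    ultimately show "n \<in> (\<Union>q\<in>{1..N div L}. {q * L - H..<q * L})" by force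
  qed
  then have "card {n. n + H \<le> N \<and> (n + 1) div L \<noteq> (n + H) div L}
      \<le> card (\<Union>q\<in>{1..N div L}. {q * L - H..<q * L})"
    by (intro card_mono) auto
  also have "\<dots> \<le> (\<Sum>q\<in>{1..N div L}. card {q * L - H..<q * L})"
    by (intro card_UN_le) auto
  also have "\<dots> \<le> (\<Sum>q\<in>{1..N div L}. H)"
    by (intro sum_mono) auto
  finally show ?thesis by simp
qed

section \<open>Calculus of growth relations\<close>

lemma seq_prec_imp_eventually_less:
  assumes "H \<prec>\<^sub>s G" "pos_seq G" "c > 0"
  shows "\<forall>\<^sub>F s in sequentially. real (H s) < c * real (G s)"
proof -
  have "\<forall>\<^sub>F s in sequentially. real (H s) / real (G s) < c"
    using assms(1,3) unfolding seq_prec_def by (rule order_tendstoD)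
  then show ?thesis
  proof eventually_elim
    case (elim s)
    have "real (G s) > 0" using assms(2) by (simp add: pos_seq_def Suc_le_eq)
    then show ?case using elim by (simp add: divide_less_eq)
  qed
qed

lemma one_prec_of_seq_prec:
  assumes "G \<prec>\<^sub>s H" "pos_seq G" "pos_seq H"
  shows "one_prec H"
  unfolding one_prec_def filterlim_at_top
proof
  fix Z :: nat
  have "\<forall>\<^sub>F s in sequentially. real (G s) < 1 / real (Suc Z) * real (H s)"
    using assms by (intro seq_prec_imp_eventually_less) auto
  then show "\<forall>\<^sub>F s in sequentially. Z \<le> H s"
  proof eventually_elim
    case (elim s)
    have "1 \<le> real (G s)" using assms(2) by (simp add: pos_seq_def)
    then have "1 < 1 / real (Suc Z) * real (H s)" using elim by linarith
    then show ?case by (simp add: field_simps)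
  qed
qed

text \<open>The witness is the geometric mean of \<open>G\<close> and \<open>H\<close>. Rounding up
  keeps it positive and costs \<open>1 / H\<close>, which tends to 0 because \<open>G\<close> is at
  least 1. This supplies the inner scale in condition (iii).\<close>

lemma seq_prec_dense:
  assumes "G \<prec>\<^sub>s H" "pos_seq G" "pos_seq H"
  shows "\<exists>H'. pos_seq H' \<and> G \<prec>\<^sub>s H' \<and> H' \<prec>\<^sub>s H"
proof -
  define H' where "H' s = nat \<lceil>sqrt (real (G s) * real (H s))\<rceil>" for s
  define q where "q s = sqrt (real (G s) / real (H s))" for s
  have pos: "real (G s) \<ge> 1" "real (H s) \<ge> 1" for s
    using assms by (auto simp: pos_seq_def)
  have root: "sqrt (real (G s) * real (H s)) > 0" for s
    using pos[of s] by (simp add: less_le_trans[OF zero_less_one])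
  have H'_ge: "sqrt (real (G s) * real (H s)) \<le> real (H' s)" for s
    unfolding H'_def by linarith
  have H'_le: "real (H' s) \<le> sqrt (real (G s) * real (H s)) + 1" for s
    using root[of s] unfolding H'_def by linarith
  have q: "q \<longlonglongrightarrow> 0"
    using tendsto_real_sqrt[OF assms(1)[unfolded seq_prec_def]] by (simp add: q_def[abs_def])
  have "1 / real (H s) \<le> real (G s) / real (H s)" for s
    using pos by (intro divide_right_mono) auto
  then have inv: "(\<lambda>s. 1 / real (H s)) \<longlonglongrightarrow> 0"
    by (intro tendsto_sandwich[OF _ _ tendsto_const assms(1)[unfolded seq_prec_def]]) auto
  have "real (G s) / real (H' s) \<le> q s" for s
  proof -
    have "real (G s) / real (H' s) \<le> real (G s) / sqrt (real (G s) * real (H s))"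
      using H'_ge root less_le_trans[OF root H'_ge] by (intro divide_left_mono mult_pos_pos) auto
    also have "\<dots> = q s"
      using pos[of s] by (simp add: q_def real_sqrt_mult real_sqrt_divide field_simps)
    finally show ?thesis .
  qed
  then have 1: "G \<prec>\<^sub>s H'"
    unfolding seq_prec_def by (intro tendsto_sandwich[OF _ _ tendsto_const q]) auto
  have "real (H' s) / real (H s) \<le> q s + 1 / real (H s)" for s
  proof -
    have "real (H' s) / real (H s) \<le> (sqrt (real (G s) * real (H s)) + 1) / real (H s)"
      using H'_le by (intro divide_right_mono) auto
    also have "\<dots> = q s + 1 / real (H s)"
      using pos[of s] by (simp add: q_def real_sqrt_mult real_sqrt_divide field_simps)
    finally show ?thesis .
  qed
  then have 2: "H' \<prec>\<^sub>s H"
    unfolding seq_prec_def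
    by (intro tendsto_sandwich[OF _ _ tendsto_const tendsto_add_zero[OF q inv]]) auto
  have "pos_seq H'"
    unfolding pos_seq_def
  proof
    fix s
    have "real (H' s) > 0" using H'_ge[of s] root[of s] by linarith
    then show "1 \<le> H' s" by simp
  qed
  with 1 2 show ?thesis by blast
qed

section \<open>Gluing the stages into one structured part\<close>

text \<open>The decomposition must not depend on \<open>s\<close>, while the coarse scale
  \<open>L s\<close> does. The growth hypothesis makes the values inherited from earlier stages
  affect at most a fraction \<open>1 / Suc s\<close> of \<open>[1, P s]\<close>.\<close>

lemma U1_good_scale_of_stable_scales:
  assumes f: "\<And>n. 0 \<le> f n \<and> f n \<le> 1"
    and Ppos: "\<And>s. P s \<ge> 1" and growth: "\<And>s. P s * (s + 2) \<le> P (Suc s)"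
    and Mpos: "\<And>s. M s \<ge> 1" and LP: "\<And>s. L s * Suc s \<le> P s" and Lpos: "\<And>s. L s \<ge> 1"
    and stable: "\<And>s. (\<Sum>m = 1..P s. \<bar>block_avg f (M s) m - block_avg f (L s) m\<bar>)
                   \<le> 3 * real (P s) / real (Suc s)"
    and H: "pos_seq H" "M \<prec>\<^sub>s H" "H \<prec>\<^sub>s L"
  shows "U1_good_scale f P H"
proof -
  note b = block_avg_bounds[OF f]
  \<comment> \<open>The endpoint of the previous stage, with 0 before the first one.\<close>
  define r where "r s = (case s of 0 \<Rightarrow> 0 | Suc s' \<Rightarrow> P s')" for s
  \<comment> \<open>The \<open>LEAST\<close> selects the stage with \<open>r s < n\<close> and
    \<open>n \<le> P s\<close>; this is the structured part.\<close>
  define F where "F n = block_avg f (L (LEAST s. n \<le> P s)) n" for n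
  define e where "e s = 1 / real (Suc s)" for s
  have e: "e \<longlonglongrightarrow> 0" unfolding e_def using LIMSEQ_inverse_real_of_nat by (simp add: inverse_eq_divide)
  have Preal: "real (P s) \<ge> 1" for s using Ppos[of s] by simp
  have posM: "pos_seq M" and posL: "pos_seq L" and posP: "pos_seq P"
    using Mpos Lpos Ppos by (auto simp: pos_seq_def)
  have "P s \<le> P (Suc s)" for s
    using growth[of s] by simp
  then have mono: "s \<le> s' \<Longrightarrow> P s \<le> P s'" for s s' by (rule lift_Suc_mono_le)
  have re: "real (r s) \<le> e s * real (P s)" for s
  proof (cases s)
    case (Suc s')
    have "real (P s' * (s' + 2)) \<le> real (P s)" using growth[of s'] Suc by (simp only: of_nat_le_iff)
    then show ?thesis by (simp add: r_def e_def Suc field_simps)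
  qed (simp add: r_def e_def)
  have Le: "real (L s) \<le> e s * real (P s)" for s
  proof -
    have "real (L s * Suc s) \<le> real (P s)" using LP by (simp only: of_nat_le_iff)
    then show ?thesis by (simp add: e_def field_simps)
  qed
  have F_eq: "F n = block_avg f (L s) n" if "r s < n" "n \<le> P s" for n s
  proof -
    have "(LEAST s. n \<le> P s) = s"
    proof (rule Least_equality)
      fix s' assume "n \<le> P s'"
      show "s \<le> s'"
      proof (rule ccontr)
        assume "\<not> s \<le> s'"
        then obtain s0 where "s = Suc s0" "s' \<le> s0" by (metis Suc_le_D not_less_eq_eq)
        then show False using that \<open>n \<le> P s'\<close> mono[of s' s0] by (simp add: r_def)
      qed
    qed (rule that)
    then show ?thesis by (simp add: F_def)
  qed
  have F01: "0 \<le> F n" "F n \<le> 1" for n unfolding F_def by (rule b)+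
  have patch: "(\<Sum>m = 1..P s. \<bar>block_avg f (L s) m - F m\<bar>) \<le> e s * real (P s)" for s
  proof -
    have "(\<Sum>m = 1..P s. \<bar>block_avg f (L s) m - F m\<bar>) \<le> (\<Sum>m = 1..P s. if m \<in> {1..r s} then 1 else 0)"
      using F_eq[of s] b F01 by (intro sum_mono) (auto intro!: abs_diff_le_1)
    also have "\<dots> = real (card ({1..P s} \<inter> {1..r s}))"
      by (subst sum.inter_restrict[symmetric]) auto
    also have "\<dots> \<le> real (r s)"
      using card_mono[of "{1..r s}" "{1..P s} \<inter> {1..r s}"] by simp
    finally show ?thesis using re[of s] by linarith
  qed
  \<comment> \<open>Hence there are at least \<open>P s / 2\<close> windows, so normalising by their
    number or by \<open>P s\<close> differs by a factor of at most 2.\<close>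
  have H_small: "\<forall>\<^sub>F s in sequentially. real (H s) < 1 / 2 * real (P s)"
  proof -
    have "\<forall>\<^sub>F s in sequentially. real (H s) < 1 / 2 * real (L s)"
      using H posL by (intro seq_prec_imp_eventually_less) auto
    then show ?thesis
    proof eventually_elim
      case (elim s)
      have "L s \<le> P s" using LP[of s] by simp
      then show ?case using elim by simp
    qed
  qed
  have mean: "has_mean (\<lambda>n. f n - F n) P 0"
    unfolding has_mean_def
  proof (rule tendsto_0_le[where K = 3, OF e], rule always_eventually, rule allI)
    fix s
    let ?a = "block_avg f (L s)"
    \<comment> \<open>The partial sum bound starts at index 0; removing that term costs at most 1,
      absorbed into a second copy of \<open>L s\<close>.\<close>
    have "{..<P s + 1} = insert 0 {1..P s}" by auto
    then have "(\<Sum>n<P s + 1. f n - ?a n) = f 0 - ?a 0 + (\<Sum>n = 1..P s. f n - ?a n)" by simp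
    moreover have "\<bar>\<Sum>n<P s + 1. f n - ?a n\<bar> \<le> real (L s)"
      using Lpos[of s] by (intro abs_sum_diff_block_avg_le f) auto
    moreover have "\<bar>f 0 - ?a 0\<bar> \<le> 1" using f b by (intro abs_diff_le_1) auto
    moreover have "1 \<le> real (L s)" using Lpos[of s] by simp
    ultimately have 1: "\<bar>\<Sum>n = 1..P s. f n - ?a n\<bar> \<le> 2 * (e s * real (P s))"
      using Le[of s] by linarith
    have "(\<Sum>n = 1..P s. f n - F n) = (\<Sum>n = 1..P s. f n - ?a n) + (\<Sum>n = 1..P s. ?a n - F n)"
      by (simp flip: sum.distrib)
    then have "\<bar>\<Sum>n = 1..P s. f n - F n\<bar> \<le> 3 * (e s * real (P s))"
      using 1 patch[of s] sum_abs[of "\<lambda>n. ?a n - F n" "{1..P s}"] by linarith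
    then show "norm ((1 / real (P s)) * (\<Sum>n = 1..P s. f n - F n)) \<le> norm (e s) * 3"
      using Preal[of s] by (simp add: abs_mult field_simps e_def)
  qed
  have gamma: "(\<lambda>s. real (card (Gamma_set F P H s)) / real (P s - H s + 1)) \<longlonglongrightarrow> 1"
  proof -
    have bd: "\<forall>\<^sub>F s in sequentially.
        norm (real (card (Gamma_set F P H s)) / real (P s - H s + 1) - 1)
          \<le> norm (real (H s) / real (L s) + 2 * e s) * 2"
      using H_small
    proof eventually_elim
      case (elim s)
      let ?X = "{1..P s - H s + 1}" and ?G = "Gamma_set F P H s"
      let ?C = "{n. n + H s \<le> P s \<and> (n + 1) div L s \<noteq> (n + H s) div L s}"
      have H1: "H s \<ge> 1" using H(1) by (simp add: pos_seq_def)
      have HP: "H s \<le> P s" using elim by linarith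
      have sub: "?G \<subseteq> ?X" by (auto simp: Gamma_set_def)
      \<comment> \<open>A bad \<open>n\<close> crosses a block boundary, starts in an earlier stage,
        or is the last point, whose window reaches \<open>P s + 1\<close> and so leaves the current
        stage.\<close>
      have "?X - ?G \<subseteq> ?C \<union> {1..r s} \<union> {P s - H s + 1}"
      proof
        fix n assume n: "n \<in> ?X - ?G"
        show "n \<in> ?C \<union> {1..r s} \<union> {P s - H s + 1}"
        proof (rule ccontr)
          assume "\<not> ?thesis"
          then have n': "r s < n" "n + H s \<le> P s" "(n + 1) div L s = (n + H s) div L s"
            using n HP by auto
          have "F (n + m) = block_avg f (L s) (n + 1)" if "m \<in> {1..H s}" for m
          proof -
            have "(n + 1) div L s \<le> (n + m) div L s" "(n + m) div L s \<le> (n + H s) div L s"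
              using that by (auto intro!: div_le_mono)
            then have "(n + m) div L s = (n + 1) div L s" using n'(3) by simp
            then have "block_avg f (L s) (n + m) = block_avg f (L s) (n + 1)"
              by (rule block_avg_cong_div)
            then show ?thesis using F_eq[of s "n + m"] n' that by simp
          qed
          then have "n \<in> ?G" using n by (simp add: Gamma_set_def)
          then show False using n by simp
        qed
      qed
      moreover have "finite ?C" by (rule finite_subset[of _ "{..P s}"]) auto
      ultimately have "card (?X - ?G) \<le> card (?C \<union> {1..r s} \<union> {P s - H s + 1})"
        by (intro card_mono) auto
      also have "\<dots> \<le> card ?C + r s + 1"
        using card_Un_le[of "?C \<union> {1..r s}" "{P s - H s + 1}"] card_Un_le[of ?C "{1..r s}"] by simp
      also have "\<dots> \<le> (P s div L s) * H s + r s + 1"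
        using card_block_crossing_le[of "L s" "H s" "P s"] Lpos[of s] H1 by simp
      finally have "real (card (?X - ?G)) \<le> real ((P s div L s) * H s + r s + 1)"
        by (simp only: of_nat_le_iff)
      also have "\<dots> \<le> real (P s) / real (L s) * real (H s) + e s * real (P s) + e s * real (P s)"
      proof -
        have "real (P s div L s) * real (H s) \<le> real (P s) / real (L s) * real (H s)"
          by (intro mult_right_mono of_nat_div_le_of_nat) auto
        moreover have "1 \<le> e s * real (P s)" using Le[of s] Lpos[of s] by linarith
        ultimately show ?thesis using re[of s] by simp
      qed
      also have "\<dots> = (real (H s) / real (L s) + 2 * e s) * real (P s)"
        by (simp add: algebra_simps)
      finally have c: "real (card (?X - ?G)) \<le> (real (H s) / real (L s) + 2 * e s) * real (P s)" .
      have "card (?X - ?G) = card ?X - card ?G"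
        using sub by (intro card_Diff_subset) (auto intro: finite_subset)
      moreover have "card ?G \<le> card ?X" using sub by (intro card_mono) auto
      ultimately have cG: "real (card ?G) = real (P s - H s + 1) - real (card (?X - ?G))"
        by simp
      have D: "real (P s) \<le> 2 * real (P s - H s + 1)" using elim HP by (simp add: of_nat_diff)
      have nn: "0 \<le> real (H s) / real (L s) + 2 * e s" by (simp add: e_def)
      have "real (card (?X - ?G)) \<le> (real (H s) / real (L s) + 2 * e s) * (2 * real (P s - H s + 1))"
        using c mult_left_mono[OF D nn] by linarith
      then have "real (card (?X - ?G)) / real (P s - H s + 1) \<le> (real (H s) / real (L s) + 2 * e s) * 2"
        by (subst divide_le_eq) (simp only: mult.assoc, simp)
      moreover have "real (card ?G) / real (P s - H s + 1) - 1 = - (real (card (?X - ?G)) / real (P s - H s + 1))"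
        unfolding cG by (simp add: field_simps del: of_nat_add of_nat_Suc)
      ultimately show ?case using nn by simp
    qed
    have "(\<lambda>s. real (H s) / real (L s) + 2 * e s) \<longlonglongrightarrow> 0"
      using H(3)[unfolded seq_prec_def] e by (intro tendsto_add_zero tendsto_mult_right_zero)
    from tendsto_0_le[OF this bd] show ?thesis by (rule LIM_zero_cancel)
  qed
  obtain H' where H': "pos_seq H'" "M \<prec>\<^sub>s H'" "H' \<prec>\<^sub>s H"
    using seq_prec_dense[OF H(2) posM H(1)] by blast
  have unf: "has_U1_norm (\<lambda>n. f n - F n) P H' 0"
    unfolding has_U1_norm_def
  proof (rule tendsto_0_le[where K = 4])
    show "(\<lambda>s. real (M s) / real (H' s) + 2 * e s) \<longlonglongrightarrow> 0"
      using H'(2)[unfolded seq_prec_def] e by (intro tendsto_add_zero tendsto_mult_right_zero)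
    have "\<forall>\<^sub>F s in sequentially. real (H' s) < 1 * real (H s)"
      using H'(3) H(1) by (intro seq_prec_imp_eventually_less) auto
    with H_small show "\<forall>\<^sub>F s in sequentially.
        norm ((1 / real (P s - H' s + 1)) *
           (\<Sum>n = 1..P s - H' s + 1. \<bar>(1 / real (H' s)) * (\<Sum>h = 0..<H' s. f (n + h) - F (n + h))\<bar>))
        \<le> norm (real (M s) / real (H' s) + 2 * e s) * 4"
    proof eventually_elim
      case (elim s)
      let ?S = "\<Sum>n = 1..P s - H' s + 1. \<bar>(1 / real (H' s)) * (\<Sum>h = 0..<H' s. f (n + h) - F (n + h))\<bar>"
      let ?q = "real (M s) / real (H' s) + 2 * e s"
      have H'1: "H' s \<ge> 1" using H'(1) by (simp add: pos_seq_def)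
      have HP: "H' s \<le> P s" using elim by linarith
      have "?S \<le> 2 * real (P s) * (real (M s) / real (H' s)) + (\<Sum>m = 1..P s. \<bar>block_avg f (M s) m - F m\<bar>)"
        using Mpos[of s] H'1 HP by (intro window_averages_le f) auto
      \<comment> \<open>Go from scale \<open>M s\<close> to \<open>L s\<close> by stability, then
        from the average at scale \<open>L s\<close> to \<open>F\<close> by
        \<open>patch\<close>.\<close>
      moreover have "(\<Sum>m = 1..P s. \<bar>block_avg f (M s) m - F m\<bar>)
          \<le> (\<Sum>m = 1..P s. \<bar>block_avg f (M s) m - block_avg f (L s) m\<bar> + \<bar>block_avg f (L s) m - F m\<bar>)"
        by (intro sum_mono) linarith
      moreover have "\<dots> \<le> 3 * (e s * real (P s)) + e s * real (P s)"
        unfolding sum.distrib using stable[of s] by (intro add_mono patch) (simp add: e_def)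
      ultimately have "?S \<le> 2 * real (P s) * (real (M s) / real (H' s)) + 4 * (e s * real (P s))"
        by linarith
      then have S: "?S \<le> (2 * ?q) * real (P s)" by (simp add: algebra_simps)
      have D: "real (P s) \<le> 2 * real (P s - H' s + 1)" using elim HP by (simp add: of_nat_diff)
      have nn: "0 \<le> ?q" by (simp add: e_def)
      have "?S \<le> (2 * ?q) * (2 * real (P s - H' s + 1))"
        using S mult_left_mono[OF D, of "2 * ?q"] nn by simp
      then have "?S / real (P s - H' s + 1) \<le> ?q * 4"
        by (simp add: divide_le_eq algebra_simps del: of_nat_add of_nat_Suc)
      moreover have "0 \<le> ?S" by (intro sum_nonneg) auto
      ultimately show ?case using nn by simp
    qed
  qed
  have "H \<preceq>\<^sub>s P"
    unfolding seq_preceq_def using H_small by eventually_elim linarith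
  moreover have "one_prec H" "one_prec H'"
    using one_prec_of_seq_prec posM H H' by blast+
  ultimately show ?thesis
    unfolding U1_good_scale_def using posP H(1) H' mean gamma unf F01
    by (intro conjI exI[of _ F] exI[of _ "\<lambda>n. f n - F n"] exI[of _ H']) auto
qed

section \<open>Choice of the subsequence and of the scales\<close>

text \<open>Being a good scale involves positive arguments only, so the value at 0 may be changed
  freely.\<close>

lemma U1_good_scale_cong:
  assumes "\<And>n. n \<ge> 1 \<Longrightarrow> f n = g n" "U1_good_scale f N H"
  shows "U1_good_scale g N H"
  using assms by (simp add: U1_good_scale_def)

theorem theorem8p2:
  fixes f :: "nat \<Rightarrow> real" and N Kp Km :: "nat \<Rightarrow> nat"
  assumes "\<forall>n\<ge>1. 0 \<le> f n \<and> f n \<le> 1"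
    and "pos_seq N" and "pos_seq Kp" and "pos_seq Km"
    and "one_prec Km" and "Km \<prec>\<^sub>s Kp" and "Kp \<preceq>\<^sub>s N"
  shows "\<exists>t :: nat \<Rightarrow> nat. strict_mono t \<and>
           (\<exists>Hp Hm :: nat \<Rightarrow> nat.
              pos_seq Hp \<and> pos_seq Hm \<and>
              (Km \<circ> t) \<preceq>\<^sub>s Hm \<and> Hm \<prec>\<^sub>s Hp \<and> Hp \<preceq>\<^sub>s (Kp \<circ> t) \<and>
              (\<forall>H :: nat \<Rightarrow> nat. pos_seq H \<and> Hm \<prec>\<^sub>s H \<and> H \<prec>\<^sub>s Hp
                 \<longrightarrow> U1_good_scale f (N \<circ> t) H))"
proof -
  \<comment> \<open>\<open>f 0\<close> is unconstrained, but the first block contains it; resetting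
    it to 0 gives bounds at every index.\<close>
  define g where "g n = (if n = 0 then 0 else f n)" for n
  have g: "0 \<le> g n \<and> g n \<le> 1" for n using assms(1) by (simp add: g_def)
  \<comment> \<open>With \<open>k = Suc s\<close>, this is the length of the ladder of
    \<open>k\<^sup>2\<close> steps of ratio \<open>k\<close>, times the spare factor
    \<open>k\<close>.\<close>
  define R where "R s = Suc s ^ ((Suc s)\<^sup>2) * Suc s" for s
  define room where "room s u \<longleftrightarrow> Km u * R s \<le> Kp u \<and> Kp u \<le> N u" for s u
  have Kle: "\<forall>\<^sub>F u in sequentially. Kp u \<le> N u"
    using assms(7) by (simp add: seq_preceq_def)
  have ratio: "\<forall>\<^sub>F u in sequentially. Km u * R s \<le> Kp u" for s
  proof -
    have R: "R s > 0" by (simp add: R_def)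
    then have "\<forall>\<^sub>F u in sequentially. real (Km u) < 1 / real (R s) * real (Kp u)"
      using assms by (intro seq_prec_imp_eventually_less) auto
    then show ?thesis
    proof eventually_elim
      case (elim u)
      then have "real (Km u * R s) < real (Kp u)" using R by (simp add: field_simps)
      then show ?case by (simp only: of_nat_less_iff less_imp_le)
    qed
  qed
  have room: "\<forall>\<^sub>F u in sequentially. room s u" for s
    unfolding room_def using ratio[of s] Kle by (rule eventually_conj)
  have N_large: "\<forall>\<^sub>F u in sequentially. Z \<le> N u" for Z
  proof -
    have "\<forall>\<^sub>F u in sequentially. Z \<le> Km u"
      using assms(5) by (simp add: one_prec_def filterlim_at_top)
    then show ?thesis using ratio[of 0] Kle
      by eventually_elim (simp add: R_def)
  qed
  \<comment> \<open>Each requirement on the next index holds eventually, so \<open>t\<close> is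
    built greedily, with both the room for the ladder and the growth factor \<open>s + 2\<close>
    depending on the stage.\<close>
  have "\<exists>t. \<forall>s. room s (t s) \<and> (t s < t (Suc s) \<and> N (t s) * (s + 2) \<le> N (t (Suc s)))"
  proof (rule dependent_nat_choice)
    show "\<exists>u. room 0 u"
      using room by (rule eventually_happens'[OF sequentially_bot])
  next
    fix u s
    have "\<forall>\<^sub>F v in sequentially. room (Suc s) v \<and> u < v \<and> N u * (s + 2) \<le> N v"
      using room N_large eventually_gt_at_top by (intro eventually_conj) auto
    then show "\<exists>v. room (Suc s) v \<and> u < v \<and> N u * (s + 2) \<le> N v"
      by (rule eventually_happens'[OF sequentially_bot])
  qed
  then obtain t where t: "\<And>s. room s (t s)" "\<And>s. t s < t (Suc s)"
      "\<And>s. N (t s) * (s + 2) \<le> N (t (Suc s))"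
    by blast
  have mono: "strict_mono t" using t(2) by (simp add: strict_mono_Suc_iff)
  have "\<exists>M\<ge>Km (t s). M * Suc s \<le> Km (t s) * Suc s ^ ((Suc s)\<^sup>2) \<and>
          (\<Sum>m = 1..N (t s). \<bar>block_avg g M m - block_avg g (M * Suc s) m\<bar>)
            \<le> 3 * real (N (t s)) / real (Suc s)" for s
  proof (rule exists_stable_scale)
    show "Km (t s) * Suc s ^ ((Suc s)\<^sup>2) * Suc s \<le> N (t s)"
      using t(1)[of s] unfolding room_def R_def mult.assoc by (blast intro: le_trans)
  qed (use g assms(4) in \<open>auto simp: pos_seq_def Suc_le_eq\<close>)
  then have "\<exists>M. \<forall>s. Km (t s) \<le> M s \<and> M s * Suc s \<le> Km (t s) * Suc s ^ ((Suc s)\<^sup>2) \<and>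
          (\<Sum>m = 1..N (t s). \<bar>block_avg g (M s) m - block_avg g (M s * Suc s) m\<bar>)
            \<le> 3 * real (N (t s)) / real (Suc s)"
    by (intro choice) blast
  then obtain M where M: "\<And>s. Km (t s) \<le> M s"
      "\<And>s. M s * Suc s \<le> Km (t s) * Suc s ^ ((Suc s)\<^sup>2)"
      "\<And>s. (\<Sum>m = 1..N (t s). \<bar>block_avg g (M s) m - block_avg g (M s * Suc s) m\<bar>)
            \<le> 3 * real (N (t s)) / real (Suc s)"
    by blast
  \<comment> \<open>The next rung of the ladder, serving as \<open>Hp\<close> with \<open>M\<close>
    as \<open>Hm\<close>; their ratio \<open>Suc s\<close> tends to infinity.\<close>
  define L where "L s = M s * Suc s" for s
  have Mpos: "M s \<ge> 1" for s using M(1)[of s] assms(4) by (meson le_trans pos_seq_def)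
  have Lpos: "L s \<ge> 1" for s using Mpos[of s] by (simp add: L_def)
  \<comment> \<open>The spare factor serves twice: it puts \<open>L\<close> below \<open>Kp\<close>
    and makes one block negligible in \<open>[1, N (t s)]\<close>.\<close>
  have LKp: "L s * Suc s \<le> Kp (t s)" for s
  proof -
    have "L s * Suc s \<le> Km (t s) * Suc s ^ ((Suc s)\<^sup>2) * Suc s"
      unfolding L_def by (intro mult_right_mono M) auto
    then show ?thesis
      using t(1)[of s] unfolding room_def R_def mult.assoc by (blast intro: le_trans)
  qed
  have "real (M s) / real (L s) = 1 / real (Suc s)" for s
    using Mpos[of s] unfolding L_def of_nat_mult by (subst nonzero_divide_mult_cancel_left) auto
  then have scales_prec: "M \<prec>\<^sub>s L"
    unfolding seq_prec_def using LIMSEQ_inverse_real_of_nat by (simp add: inverse_eq_divide)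
  have "U1_good_scale f (N \<circ> t) H" if "pos_seq H" "M \<prec>\<^sub>s H" "H \<prec>\<^sub>s L" for H
  proof (rule U1_good_scale_cong)
    show "U1_good_scale g (N \<circ> t) H"
    proof (rule U1_good_scale_of_stable_scales[where M = M and L = L])
      show "L s * Suc s \<le> (N \<circ> t) s" for s
        using LKp[of s] t(1)[of s] by (simp add: room_def)
      show "(\<Sum>m = 1..(N \<circ> t) s. \<bar>block_avg g (M s) m - block_avg g (L s) m\<bar>)
          \<le> 3 * real ((N \<circ> t) s) / real (Suc s)" for s
        using M(3)[of s] by (simp add: L_def)
      show "(N \<circ> t) s * (s + 2) \<le> (N \<circ> t) (Suc s)" for s
        using t(3)[of s] by simp
      show "(N \<circ> t) s \<ge> 1" for s
        using assms(2) by (simp add: pos_seq_def)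
    qed (fact g Mpos Lpos that)+
  qed (simp add: g_def)
  moreover have "L s \<le> Kp (t s)" for s
    using LKp[of s] by simp
  ultimately show ?thesis
    using mono scales_prec M(1) Mpos Lpos
    by (intro exI[of _ t] exI[of _ L] exI[of _ M] conjI) (auto simp: pos_seq_def seq_preceq_def)
qed

end
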